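(* Let $G$ be a graph with $\alpha(G)\ge 2$. If $G$ has no induced subgraph isomorphic to $C_k$ for any $k$ with $4\le k\le 2\alpha(G)$, then $oh(G)\ge \chi(G)$.
   Context: All graphs are finite, without loops or parallel edges. $C_k$ is the cycle on $k$ vertices; $\alpha(G)$ is the independence number and $\chi(G)$ the chromatic number of $G$. A graph $G$ has an odd clique minor of size at least $k$ if there are $k$ vertex-disjoint trees in $G$ such that every two of them are joined by an edge of $G$, and all vertices of the trees can be two-colored so that edges within each tree are bichromatic while the edges between trees are monochromatic (hence all trivial, one-vertex, trees receive the same color). The odd Hadwiger number $oh(G)$ is the largest $k$ such that $G$ has an odd clique minor of size $k$. *)

theory Defs
  imports Main "HOL-Library.Ramsey" "HOL-Library.FuncSet" "HOL-Library.Disjoint_Sets"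
begin

text \<open>A graph is given by its vertex set and its set of edges, an edge being a
  two-element set of vertices, as for \<^const>\<open>indep\<close> and \<^const>\<open>clique\<close> in Ramsey theory.\<close>

definition simple_graph :: "'a set \<Rightarrow> 'a set set \<Rightarrow> bool" where
  "simple_graph V E \<longleftrightarrow> finite V \<and> E \<subseteq> nsets V 2"

definition independence_number :: "'a set \<Rightarrow> 'a set set \<Rightarrow> nat" where
  "independence_number V E = Max (card ` {S. S \<subseteq> V \<and> indep S E})"

definition proper_colouring :: "'a set \<Rightarrow> 'a set set \<Rightarrow> nat \<Rightarrow> ('a \<Rightarrow> nat) \<Rightarrow> bool" where
  "proper_colouring V E k c \<longleftrightarrow>
     c \<in> V \<rightarrow> {..<k} \<and> (\<forall>u\<in>V. \<forall>v\<in>V. {u, v} \<in> E \<longrightarrow> c u \<noteq> c v)"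

definition chromatic_number :: "'a set \<Rightarrow> 'a set set \<Rightarrow> nat" where
  "chromatic_number V E = (LEAST k. \<exists>c. proper_colouring V E k c)"

definition graph_isomorphic ::
  "'a set \<Rightarrow> 'a set set \<Rightarrow> 'b set \<Rightarrow> 'b set set \<Rightarrow> bool" where
  "graph_isomorphic V E W F \<longleftrightarrow>
     (\<exists>f. bij_betw f V W \<and> (\<forall>u\<in>V. \<forall>v\<in>V. {u, v} \<in> E \<longleftrightarrow> {f u, f v} \<in> F))"

definition induced_edges :: "'a set set \<Rightarrow> 'a set \<Rightarrow> 'a set set" where
  "induced_edges E S = {e \<in> E. e \<subseteq> S}"

definition has_induced_subgraph ::
  "'a set \<Rightarrow> 'a set set \<Rightarrow> 'b set \<Rightarrow> 'b set set \<Rightarrow> bool" where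
  "has_induced_subgraph V E W F \<longleftrightarrow>
     (\<exists>S\<subseteq>V. graph_isomorphic S (induced_edges E S) W F)"

text \<open>The cycle on \<open>k\<close> vertices has vertex set \<open>{..<k}\<close>; meaningful for \<open>k \<ge> 3\<close> only.\<close>

definition cycle_edges :: "nat \<Rightarrow> nat set set" where
  "cycle_edges k = {{i, Suc i mod k} |i. i < k}"

definition graph_connected :: "'a set \<Rightarrow> 'a set set \<Rightarrow> bool" where
  "graph_connected V E \<longleftrightarrow>
     V \<noteq> {} \<and> (\<forall>u\<in>V. \<forall>v\<in>V. (u, v) \<in> {(x, y). {x, y} \<in> E}\<^sup>*)"

text \<open>A (not necessarily induced) cycle as the cyclic list of its vertices.\<close>

definition is_cycle :: "'a set set \<Rightarrow> 'a list \<Rightarrow> bool" where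
  "is_cycle E xs \<longleftrightarrow> 3 \<le> length xs \<and> distinct xs \<and>
     (\<forall>i<length xs. {xs ! i, xs ! (Suc i mod length xs)} \<in> E)"

definition is_tree :: "'a set \<Rightarrow> 'a set set \<Rightarrow> bool" where
  "is_tree V E \<longleftrightarrow> simple_graph V E \<and> graph_connected V E \<and> (\<nexists>xs. is_cycle E xs)"

text \<open>The trees \<open>(T i, F i)\<close>, \<open>i < k\<close>, are subgraphs of the graph, not necessarily induced.
  Each two of them are joined by some monochromatic edge; as usual for odd minors, further
  edges of the graph between two trees, and edges of the graph inside \<open>T i\<close> that do not belong
  to the tree, are unconstrained by the two-colouring \<open>c\<close>.\<close>

definition has_odd_clique_minor :: "'a set \<Rightarrow> 'a set set \<Rightarrow> nat \<Rightarrow> bool" where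
  "has_odd_clique_minor V E k \<longleftrightarrow>
     (\<exists>(T :: nat \<Rightarrow> 'a set) (F :: nat \<Rightarrow> 'a set set) (c :: 'a \<Rightarrow> bool).
        (\<forall>i<k. T i \<subseteq> V \<and> F i \<subseteq> E \<and> is_tree (T i) (F i)) \<and>
        disjoint_family_on T {..<k} \<and>
        (\<forall>i<k. \<forall>u v. {u, v} \<in> F i \<longrightarrow> c u \<noteq> c v) \<and>
        (\<forall>i<k. \<forall>j<k. i \<noteq> j \<longrightarrow> (\<exists>u\<in>T i. \<exists>v\<in>T j. {u, v} \<in> E \<and> c u = c v)))"

definition odd_hadwiger_number :: "'a set \<Rightarrow> 'a set set \<Rightarrow> nat" where
  "odd_hadwiger_number V E = Max {k. has_odd_clique_minor V E k}"

lemma independence_number_attained: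
  assumes "simple_graph V E"
  shows "\<exists>S\<subseteq>V. indep S E \<and> card S = independence_number V E"
    and "S \<subseteq> V \<Longrightarrow> indep S E \<Longrightarrow> card S \<le> independence_number V E"
proof -
  have fin: "finite (card ` {S. S \<subseteq> V \<and> indep S E})"
    using assms by (simp add: simple_graph_def)
  have "card ` {S. S \<subseteq> V \<and> indep S E} \<noteq> {}"
    using null_indep by blast
  from Max_in[OF fin this]
  show "\<exists>S\<subseteq>V. indep S E \<and> card S = independence_number V E"
    by (auto simp: independence_number_def)
  show "S \<subseteq> V \<Longrightarrow> indep S E \<Longrightarrow> card S \<le> independence_number V E"
    unfolding independence_number_def by (rule Max_ge[OF fin]) blast
qed

lemma chromatic_number_attained:
  assumes "simple_graph V E"
  shows "\<exists>c. proper_colouring V E (chromatic_number V E) c"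
proof -
  obtain f where f: "bij_betw f V {0..<card V}"
    using assms ex_bij_betw_finite_nat unfolding simple_graph_def by blast
  have "proper_colouring V E (card V) f"
    unfolding proper_colouring_def
  proof (intro conjI ballI impI)
    show "f \<in> V \<rightarrow> {..<card V}"
      using f by (auto simp: bij_betw_def)
    fix u v assume uv: "u \<in> V" "v \<in> V" "{u, v} \<in> E"
    then have "card {u, v} = 2"
      using assms by (auto simp: simple_graph_def nsets_def)
    then have "u \<noteq> v" by auto
    then show "f u \<noteq> f v"
      using f uv by (auto simp: bij_betw_def inj_on_def)
  qed
  then have "\<exists>c. proper_colouring V E (card V) c"
    by (rule exI[of _ f])
  then show ?thesis
    unfolding chromatic_number_def by (rule LeastI)
qed

lemma has_odd_clique_minor_le_card:
  assumes "simple_graph V E" "has_odd_clique_minor V E k"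
  shows "k \<le> card V"
proof -
  obtain T :: "nat \<Rightarrow> 'a set" and F c where
    "\<forall>i<k. T i \<subseteq> V \<and> F i \<subseteq> E \<and> is_tree (T i) (F i)"
    and disj: "disjoint_family_on T {..<k}"
    and "\<forall>i<k. \<forall>u v. {u, v} \<in> F i \<longrightarrow> (c u :: bool) \<noteq> c v"
    using assms(2) unfolding has_odd_clique_minor_def by (elim exE conjE) (rule that)
  then have T: "T i \<subseteq> V \<and> is_tree (T i) (F i)" if "i < k" for i
    using that by simp
  have "\<exists>x. x \<in> T i" if "i < k" for i
    using T[OF that] by (auto simp: is_tree_def graph_connected_def)
  then have "\<forall>i. \<exists>x. i < k \<longrightarrow> x \<in> T i"
    by blast
  then obtain x where x: "\<And>i. i < k \<Longrightarrow> x i \<in> T i"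
    using choice[of "\<lambda>i y. i < k \<longrightarrow> y \<in> T i"] by blast
  have "inj_on x {..<k}"
  proof (rule inj_onI)
    fix i j assume ij: "i \<in> {..<k}" "j \<in> {..<k}" "x i = x j"
    then have "x i \<in> T i \<inter> T j"
      using x[of i] x[of j] by simp
    then show "i = j"
      using disj ij unfolding disjoint_family_on_def by blast
  qed
  moreover have "x ` {..<k} \<subseteq> V"
    using x T by blast
  ultimately show ?thesis
    using assms(1) card_inj_on_le[of x "{..<k}" V] by (simp add: simple_graph_def)
qed

lemma odd_hadwiger_number_attained:
  assumes "simple_graph V E"
  shows "has_odd_clique_minor V E (odd_hadwiger_number V E)"
    and "has_odd_clique_minor V E k \<Longrightarrow> k \<le> odd_hadwiger_number V E"
proof -
  have fin: "finite {k. has_odd_clique_minor V E k}"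
  proof (rule finite_subset)
    show "{k. has_odd_clique_minor V E k} \<subseteq> {..card V}"
      using has_odd_clique_minor_le_card[OF assms] by blast
  qed simp
  have "has_odd_clique_minor V E 0"
    by (simp add: has_odd_clique_minor_def disjoint_family_on_def)
  then have "{k. has_odd_clique_minor V E k} \<noteq> {}"
    by blast
  from Max_in[OF fin this] show "has_odd_clique_minor V E (odd_hadwiger_number V E)"
    by (simp add: odd_hadwiger_number_def)
  show "has_odd_clique_minor V E k \<Longrightarrow> k \<le> odd_hadwiger_number V E"
    unfolding odd_hadwiger_number_def by (rule Max_ge[OF fin]) simp
qed

end

theory Submission
  imports Defs
begin

text \<open>Put \<open>n = 2 \<alpha> + 1\<close>. A hole longer than \<open>n\<close> contains more than \<open>\<alpha>\<close> independent vertices, so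
  every hole has length exactly \<open>n\<close>. If there is no hole, the graph is chordal and can be coloured
  with as many colours as its largest clique has vertices. Otherwise fix a hole. The bounds on holes
  and independent sets force every vertex to be adjacent either to the whole hole or to exactly
  three consecutive vertices of it (counting a hole vertex as its own neighbour), and replacing
  hole vertices by their twins shows that the graph is a cycle of cliques \<open>A 0, \<dots>, A (n - 1)\<close>
  joined completely to a further clique \<open>D\<close>. Both the number of colours needed and
  the size of an odd clique minor are then compared with
  \<open>|D| + max (|A i| + |A (i + 1)|) + min |A i|\<close>.\<close>

section \<open>Closed adjacency, holes and blow-ups of cycles\<close>

text \<open>With closed adjacency a hole vertex satisfies the same condition as its twins, so later
  case distinctions need not separate vertices on the hole from vertices off it.\<close>

definition cadj :: "'a set set \<Rightarrow> 'a \<Rightarrow> 'a \<Rightarrow> bool" where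
  "cadj E x y \<longleftrightarrow> x = y \<or> {x, y} \<in> E"

text \<open>Closed adjacency of the cycle on \<open>{..<n}\<close>. It is spelled out without
  \<open>mod\<close>, so that distances along the cycle become linear arithmetic.\<close>

definition near :: "nat \<Rightarrow> nat \<Rightarrow> nat \<Rightarrow> bool" where
  "near n i j \<longleftrightarrow> i = j \<or> Suc i = j \<or> Suc j = i \<or> (i = 0 \<and> Suc j = n) \<or> (j = 0 \<and> Suc i = n)"

text \<open>An indexed embedding rather than a vertex set: rotating the hole is then composition
  with a shift, and exchanging one vertex is a function update.\<close>

definition hole :: "'a set \<Rightarrow> 'a set set \<Rightarrow> nat \<Rightarrow> (nat \<Rightarrow> 'a) \<Rightarrow> bool" where
  "hole V E n f \<longleftrightarrow> inj_on f {..<n} \<and> f ` {..<n} \<subseteq> V \<and>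
     (\<forall>i<n. \<forall>j<n. cadj E (f i) (f j) \<longleftrightarrow> near n i j)"

definition simplicial :: "'a set \<Rightarrow> 'a set set \<Rightarrow> 'a \<Rightarrow> bool" where
  "simplicial V E u \<longleftrightarrow> clique {x \<in> V. {u, x} \<in> E} E"

definition chordal :: "'a set \<Rightarrow> 'a set set \<Rightarrow> bool" where
  "chordal V E \<longleftrightarrow> (\<forall>n\<ge>4. \<forall>f. \<not> hole V E n f)"

text \<open>The case \<open>i = j\<close> of the last clause makes every \<open>A i\<close> a
  clique, and the clause on \<open>D\<close> makes \<open>D\<close> one. Parts may be empty.\<close>

definition cycle_blowup ::
  "'a set \<Rightarrow> 'a set set \<Rightarrow> nat \<Rightarrow> 'a set \<Rightarrow> (nat \<Rightarrow> 'a set) \<Rightarrow> bool" where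
  "cycle_blowup V E n D A \<longleftrightarrow> V = D \<union> (\<Union>i<n. A i) \<and>
     (\<forall>i<n. \<forall>j<n. i \<noteq> j \<longrightarrow> A i \<inter> A j = {}) \<and> (\<forall>i<n. D \<inter> A i = {}) \<and>
     (\<forall>x\<in>D. \<forall>y\<in>V. cadj E x y) \<and>
     (\<forall>i<n. \<forall>j<n. \<forall>x\<in>A i. \<forall>y\<in>A j. cadj E x y \<longleftrightarrow> near n i j)"

lemma cadj_sym: "cadj E x y \<longleftrightarrow> cadj E y x"
  by (auto simp: cadj_def insert_commute)

lemma near_sym: "near n i j \<longleftrightarrow> near n j i"
  by (auto simp: near_def)

lemma no_loop: "simple_graph V E \<Longrightarrow> {x, x} \<notin> E"
  by (auto simp: simple_graph_def nsets_def)

lemma cycle_edges_iff_near: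
  assumes "i < n" "j < n" "3 \<le> n"
  shows "{i, j} \<in> cycle_edges n \<longleftrightarrow> near n i j \<and> i \<noteq> j"
proof -
  have m: "Suc k mod n = (if Suc k = n then 0 else Suc k)" if "k < n" for k
    using that by (auto simp: mod_Suc)
  have "{i, j} \<in> cycle_edges n \<longleftrightarrow> Suc i mod n = j \<or> Suc j mod n = i"
    using assms(1,2) by (auto simp: cycle_edges_def doubleton_eq_iff)
  also have "\<dots> \<longleftrightarrow> near n i j \<and> i \<noteq> j"
    unfolding m[OF assms(1)] m[OF assms(2)] near_def using assms by auto
  finally show ?thesis .
qed

lemma hole_imp_induced_cycle:
  assumes "simple_graph V E" "hole V E n f" "3 \<le> n"
  shows "has_induced_subgraph V E {..<n} (cycle_edges n)"
proof -
  define S where "S = f ` {..<n}"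
  define g where "g = the_inv_into {..<n} f"
  have inj: "inj_on f {..<n}" and SV: "S \<subseteq> V"
    and ad: "\<And>i j. i < n \<Longrightarrow> j < n \<Longrightarrow> cadj E (f i) (f j) \<longleftrightarrow> near n i j"
    using assms(2) by (auto simp: hole_def S_def)
  have bij: "bij_betw g S {..<n}"
    unfolding g_def S_def using inj by (intro bij_betw_the_inv_into inj_on_imp_bij_betw)
  have gf: "g (f i) = i" if "i < n" for i
    using inj that by (simp add: g_def the_inv_into_f_f)
  have "{f i, f j} \<in> induced_edges E S \<longleftrightarrow> {g (f i), g (f j)} \<in> cycle_edges n"
    if "i < n" "j < n" for i j
  proof -
    have "{f i, f j} \<in> induced_edges E S \<longleftrightarrow> cadj E (f i) (f j) \<and> i \<noteq> j"
      using that no_loop[OF assms(1)] inj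
      by (auto simp: induced_edges_def S_def cadj_def inj_on_def)
    then show ?thesis
      using ad cycle_edges_iff_near that assms(3) gf by simp
  qed
  then have "graph_isomorphic S (induced_edges E S) {..<n} (cycle_edges n)"
    unfolding graph_isomorphic_def using bij by (intro exI[of _ g]) (auto simp: S_def)
  then show ?thesis
    unfolding has_induced_subgraph_def using SV by blast
qed

text \<open>The closing vertex \<open>x\<close> takes the new last index \<open>m + 1\<close>, which
  is cyclically next to both ends of the path; \<open>2 \<le> m\<close> gives length at least 4. It
  serves for shortest paths, for arcs of a hole and for 4-cycles.\<close>

lemma induced_path_hole:
  assumes "2 \<le> m" "inj_on p {..m}" "p ` {..m} \<subseteq> W" "x \<in> W" "x \<notin> p ` {..m}"
    and "\<And>i j. i \<le> m \<Longrightarrow> j \<le> m \<Longrightarrow> {p i, p j} \<in> E \<longleftrightarrow> Suc i = j \<or> Suc j = i"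
    and "\<And>i. i \<le> m \<Longrightarrow> {x, p i} \<in> E \<longleftrightarrow> i = 0 \<or> i = m"
  shows "hole W E (m + 2) (p(Suc m := x))"
  unfolding hole_def
proof (intro conjI allI impI)
  have e: "{..<m + 2} = insert (Suc m) {..m}" by auto
  show "inj_on (p(Suc m := x)) {..<m + 2}"
    unfolding e using assms(2,5) by (auto simp: inj_on_def)
  show "(p(Suc m := x)) ` {..<m + 2} \<subseteq> W"
    unfolding e using assms(3,4) by auto
  fix i j assume ij: "i < m + 2" "j < m + 2"
  have i: "i \<le> m \<or> i = Suc m" and j: "j \<le> m \<or> j = Suc m" using ij by auto
  have pe: "p i = p j \<longleftrightarrow> i = j" if "i \<le> m" "j \<le> m"
    using assms(2) that by (auto simp: inj_on_def)
  have px: "p k \<noteq> x" if "k \<le> m" for k using assms(5) that by auto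
  show "cadj E ((p(Suc m := x)) i) ((p(Suc m := x)) j) = near (m + 2) i j"
    using i j
  proof (elim disjE)
    assume "i \<le> m" "j \<le> m"
    then show ?thesis using pe assms(1) by (auto simp: cadj_def near_def assms(6))
  next
    assume "i \<le> m" "j = Suc m"
    then show ?thesis using px[of i] assms(1) assms(7)[of i]
      by (auto simp: cadj_def near_def insert_commute)
  next
    assume "i = Suc m" "j \<le> m"
    then show ?thesis using px[of j] assms(1) assms(7)[of j]
      by (auto simp: cadj_def near_def)
  next
    assume "i = Suc m" "j = Suc m"
    then show ?thesis by (auto simp: cadj_def near_def)
  qed
qed

section \<open>Induced paths and chordal graphs\<close>

text \<open>In a walk with the least number of steps, a repeated vertex or a chord would allow a
  shortcut to a shorter walk from \<open>s\<close> to \<open>t\<close>.\<close>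

lemma shortest_path_induced:
  assumes loop: "\<And>x. {x, x} \<notin> E"
    and "s \<in> U" "(s, t) \<in> {(x, y). x \<in> U \<and> y \<in> U \<and> {x, y} \<in> E}\<^sup>*"
  shows "\<exists>p m. p 0 = s \<and> p m = t \<and> p ` {..m} \<subseteq> U \<and> inj_on p {..m} \<and>
    (\<forall>i\<le>m. \<forall>j\<le>m. {p i, p j} \<in> E \<longleftrightarrow> Suc i = j \<or> Suc j = i)"
proof -
  define Q where "Q = {(x, y). x \<in> U \<and> y \<in> U \<and> {x, y} \<in> E}"
  define m where "m = (LEAST m. (s, t) \<in> Q ^^ m)"
  have ex: "\<exists>m. (s, t) \<in> Q ^^ m"
    using assms(3) unfolding Q_def[symmetric] by (simp add: rtrancl_power)
  have mQ: "(s, t) \<in> Q ^^ m" unfolding m_def using ex by (rule LeastI_ex)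
  have mmin: "m \<le> k" if "(s, t) \<in> Q ^^ k" for k
    unfolding m_def using that by (rule Least_le)
  obtain p where p: "p 0 = s" "p m = t" "\<And>i. i < m \<Longrightarrow> (p i, p (Suc i)) \<in> Q"
    using mQ unfolding relpow_fun_conv by blast
  have pQ: "(p i, p (i + d)) \<in> Q ^^ d" if "i + d \<le> m" for i d
    unfolding relpow_fun_conv using that p(3)
    by (intro exI[of _ "\<lambda>k. p (i + k)"]) auto
  have pre: "(s, p i) \<in> Q ^^ i" if "i \<le> m" for i
    using pQ[of 0 i] that p(1) by simp
  have post: "(p j, t) \<in> Q ^^ (m - j)" if "j \<le> m" for j
    using pQ[of j "m - j"] that p(2) by simp
  have U: "p i \<in> U" if "i \<le> m" for i
    using that p(1) p(3)[of "i - 1"] assms(2) by (cases i) (auto simp: Q_def)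
  have inj: "p i \<noteq> p j" if "i < j" "j \<le> m" for i j
  proof
    assume "p i = p j"
    then have "(s, t) \<in> Q ^^ (i + (m - j))"
      using pre[of i] post[of j] that relpow_add[of i "m - j" Q] by auto
    from mmin[OF this] that show False by simp
  qed
  have far: "Suc i = j" if "i < j" "j \<le> m" "{p i, p j} \<in> E" for i j
  proof -
    have "(p i, p j) \<in> Q" using that U by (auto simp: Q_def)
    then have "(s, p j) \<in> Q ^^ Suc i"
      using pre[of i] that by auto
    then have "(s, t) \<in> Q ^^ (Suc i + (m - j))"
      using post[of j] that relpow_add[of "Suc i" "m - j" Q] by auto
    from mmin[OF this] that show ?thesis by simp
  qed
  show ?thesis
  proof (intro exI[of _ p] exI[of _ m] conjI allI impI)
    show "inj_on p {..m}"
      by (rule inj_onI) (metis inj atMost_iff linorder_neqE_nat)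
    show "p ` {..m} \<subseteq> U" using U by auto
    fix i j assume ij: "i \<le> m" "j \<le> m"
    have "{p i, p j} \<in> E" if "Suc i = j" using p(3)[of i] that ij by (auto simp: Q_def)
    moreover have "{p i, p j} \<in> E" if "Suc j = i"
      using p(3)[of j] that ij by (auto simp: Q_def insert_commute)
    moreover have "Suc i = j \<or> Suc j = i" if e: "{p i, p j} \<in> E"
      using far[of i j] far[of j i] e loop ij
      by (cases i j rule: linorder_cases) (auto simp: insert_commute)
    ultimately show "{p i, p j} \<in> E \<longleftrightarrow> Suc i = j \<or> Suc j = i" by blast
  qed (use p in auto)
qed

lemma hole_mono:
  assumes "hole U E n f" "U \<subseteq> W"
  shows "hole W E n f"
proof -
  have "f ` {..<n} \<subseteq> W"
    using assms order_trans[of "f ` {..<n}" U W] by (simp add: hole_def)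
  then show ?thesis using assms(1) by (simp add: hole_def)
qed

lemma chordal_mono: "chordal W E \<Longrightarrow> U \<subseteq> W \<Longrightarrow> chordal U E"
  unfolding chordal_def using hole_mono by blast

text \<open>Dirac's argument: the neighbours outside a component \<open>C\<close> of the non-neighbours of \<open>v\<close>
  form a clique, since otherwise a shortest path through \<open>C\<close> closes up with \<open>v\<close> to a hole.\<close>

lemma chordal_nonadjacent_simplicial:
  assumes loop: "\<And>x. {x, x} \<notin> E"
    and "finite W" "chordal W E" "v \<in> W" "w \<in> W" "\<not> cadj E v w"
  shows "\<exists>u\<in>W. \<not> cadj E v u \<and> simplicial W E u"
  using assms(2-)
proof (induction W arbitrary: v w rule: finite_psubset_induct)
  case (psubset W)
  define X where "X = {x \<in> W. \<not> cadj E v x}"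
  define R where "R = {(x, y). x \<in> X \<and> y \<in> X \<and> {x, y} \<in> E}"
  define C where "C = {x. (w, x) \<in> R\<^sup>*}"
  define S where "S = {s \<in> W - C. \<exists>c\<in>C. {s, c} \<in> E}"
  have wX: "w \<in> X" using psubset.prems by (simp add: X_def)
  have wC: "w \<in> C" by (simp add: C_def)
  have CX: "x \<in> X" if "x \<in> C" for x
    using that wX unfolding C_def by (auto elim: rtranclE simp: R_def)
  have ext: "y \<in> C" if "x \<in> C" "y \<in> X" "{x, y} \<in> E" for x y
    using that CX[OF that(1)] unfolding C_def
    by (auto intro: rtrancl_into_rtrancl simp: R_def)
  have Sv: "{v, s} \<in> E" if sS: "s \<in> S" for s
  proof -
    obtain c where c: "c \<in> C" "{s, c} \<in> E" "s \<in> W" "s \<notin> C"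
      using sS by (auto simp: S_def)
    have "s \<notin> X" using ext[of c s] c by (auto simp: insert_commute)
    then have "cadj E v s" using c by (simp add: X_def)
    moreover have "s \<noteq> v" using c CX[of c] by (auto simp: X_def cadj_def)
    ultimately show ?thesis by (auto simp: cadj_def)
  qed
  have symR: "sym R" by (auto simp: sym_def R_def insert_commute)
  have conn: "(a, b) \<in> {(x, y). x \<in> C \<and> y \<in> C \<and> {x, y} \<in> E}\<^sup>*" if "a \<in> C" "b \<in> C" for a b
  proof -
    have "(a, w) \<in> R\<^sup>*" using that(1) sym_rtrancl[OF symR] by (auto simp: C_def sym_def)
    then have "(a, b) \<in> R\<^sup>*" using that(2) by (auto simp: C_def)
    then show ?thesis
    proof (induction)
      case (step y z)
      have "(w, y) \<in> R\<^sup>*" using \<open>(a, y) \<in> R\<^sup>*\<close> that(1) by (auto simp: C_def)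
      then have "y \<in> C" "z \<in> C" using step.hyps by (auto simp: C_def)
      then have "(y, z) \<in> {(x, y). x \<in> C \<and> y \<in> C \<and> {x, y} \<in> E}"
        using step.hyps by (auto simp: R_def)
      with step.IH show ?case by (rule rtrancl_into_rtrancl)
    qed simp
  qed
  have cliqueS: "{s, t} \<in> E" if st: "s \<in> S" "t \<in> S" "s \<noteq> t" for s t
  proof (rule ccontr)
    assume nst: "{s, t} \<notin> E"
    define U where "U = C \<union> {s, t}"
    define Q where "Q = {(x, y). x \<in> U \<and> y \<in> U \<and> {x, y} \<in> E}"
    obtain a where a: "a \<in> C" "{s, a} \<in> E" using st by (auto simp: S_def)
    obtain b where b: "b \<in> C" "{t, b} \<in> E" using st by (auto simp: S_def)
    have "{(x, y). x \<in> C \<and> y \<in> C \<and> {x, y} \<in> E} \<subseteq> Q" by (auto simp: Q_def U_def)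
    from rtrancl_mono[OF this] have "(a, b) \<in> Q\<^sup>*" using conn[OF a(1) b(1)] by blast
    moreover have "(s, a) \<in> Q" "(b, t) \<in> Q"
      using a b by (auto simp: Q_def U_def insert_commute)
    ultimately have st_path: "(s, t) \<in> Q\<^sup>*"
      by (meson converse_rtrancl_into_rtrancl rtrancl_into_rtrancl)
    have sU: "s \<in> U" by (simp add: U_def)
    obtain m p where p: "p 0 = s" "p m = t" "p ` {..m} \<subseteq> U" "inj_on p {..m}"
      "\<forall>i\<le>m. \<forall>j\<le>m. {p i, p j} \<in> E \<longleftrightarrow> Suc i = j \<or> Suc j = i"
      using shortest_path_induced[OF loop sU st_path[unfolded Q_def]] by blast
    have m0: "m \<noteq> 0" using p st by auto
    moreover have "m \<noteq> 1" using p(1,2) p(5) nst m0 by auto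
    ultimately have m2: "2 \<le> m" by simp
    have CnE: "{v, x} \<notin> E" "x \<noteq> v" if "x \<in> C" for x
      using CX[OF that] by (auto simp: X_def cadj_def)
    have UW: "U \<subseteq> W" using CX st by (auto simp: U_def X_def S_def)
    have vU: "v \<notin> U" using CnE(2) Sv[OF st(1)] Sv[OF st(2)] loop by (auto simp: U_def)
    have "hole W E (m + 2) (p(Suc m := v))"
    proof (rule induced_path_hole[OF m2 p(4) _ psubset.prems(2)])
      show "p ` {..m} \<subseteq> W" "v \<notin> p ` {..m}" using p(3) UW vU by auto
      fix i assume i: "i \<le> m"
      \<comment> \<open>By injectivity the path meets \<open>s\<close> and \<open>t\<close> only at
        its ends, so its interior lies among the non-neighbours of \<open>v\<close>.\<close>
      have "p i \<in> C" if "i \<noteq> 0" "i \<noteq> m"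
      proof -
        have "p i \<noteq> p 0" "p i \<noteq> p m" using p(4) that i by (auto simp: inj_on_def)
        then show ?thesis using p(1-3) i by (auto simp: U_def)
      qed
      then show "{v, p i} \<in> E \<longleftrightarrow> i = 0 \<or> i = m"
        using CnE Sv st p(1,2) by auto
    qed (use p(5) in auto)
    then show False using psubset.prems(1) m2 by (auto simp: chordal_def)
  qed
  \<comment> \<open>\<open>H\<close> misses \<open>v\<close>, so the induction hypothesis applies to
    it. A vertex of \<open>C\<close> has all its neighbours in \<open>H\<close>, hence if it is
    simplicial in \<open>H\<close> it is simplicial in \<open>W\<close>; it remains to find such a
    vertex inside \<open>C\<close>.\<close>
  define H where "H = C \<union> S"
  have "v \<notin> C" using CX[of v] by (auto simp: X_def cadj_def)
  moreover have "v \<notin> S" using Sv[of v] loop by auto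
  moreover have "C \<subseteq> W" using CX by (auto simp: X_def)
  ultimately have HW: "H \<subset> W"
    using psubset.prems(2) by (auto simp: H_def S_def)
  have lift: ?case if u: "u \<in> C" "simplicial H E u" for u
  proof -
    have "{x \<in> W. {u, x} \<in> E} = {x \<in> H. {u, x} \<in> E}"
      using HW u(1) by (auto simp: H_def S_def insert_commute)
    then show ?thesis using u CX[OF u(1)] by (auto simp: simplicial_def X_def)
  qed
  have IH: "\<exists>u\<in>H. \<not> cadj E a u \<and> simplicial H E u" if "a \<in> H" "b \<in> H" "\<not> cadj E a b" for a b
    using psubset.IH[OF HW chordal_mono[OF psubset.prems(1)]] HW that by blast
  show ?case
  \<comment> \<open>A simplicial vertex of \<open>H\<close> not adjacent to some
    \<open>s \<in> S\<close> avoids the clique \<open>S\<close>. If instead \<open>S\<close> is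
    complete to \<open>H\<close>, a simplicial vertex not adjacent to some \<open>c \<in> C\<close>
    avoids \<open>S\<close> as well. If neither choice exists, \<open>H\<close> is a clique and
    \<open>w\<close> itself works.\<close>
  proof (cases "\<exists>s\<in>S. \<exists>b\<in>H. \<not> cadj E s b")
    case True
    then obtain s b where sb: "s \<in> S" "b \<in> H" "\<not> cadj E s b" by blast
    then obtain u where u: "u \<in> H" "\<not> cadj E s u" "simplicial H E u"
      using IH[of s b] by (auto simp: H_def)
    have "u \<notin> S" using cliqueS[of s u] sb u by (auto simp: cadj_def)
    then show ?thesis using u lift by (auto simp: H_def)
  next
    case False
    show ?thesis
    proof (cases "\<exists>c\<in>C. \<exists>b\<in>H. \<not> cadj E c b")
      case True
      then obtain c b where cb: "c \<in> C" "b \<in> H" "\<not> cadj E c b" by blast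
      then obtain u where u: "u \<in> H" "\<not> cadj E c u" "simplicial H E u"
        using IH[of c b] by (auto simp: H_def)
      have "u \<notin> S" using False cb u by (auto simp: H_def cadj_sym)
      then show ?thesis using u lift by (auto simp: H_def)
    next
      case f2: False
      have "clique H E" using False f2 by (auto simp: clique_def H_def cadj_def)
      then have "simplicial H E w" by (auto simp: simplicial_def clique_def)
      then show ?thesis using lift wC by blast
    qed
  qed
qed

lemma chordal_simplicial:
  assumes "\<And>x. {x, x} \<notin> E" "finite W" "chordal W E" "W \<noteq> {}"
  shows "\<exists>u\<in>W. simplicial W E u"
proof (cases "\<exists>v\<in>W. \<exists>w\<in>W. \<not> cadj E v w")
  case True
  then show ?thesis using chordal_nonadjacent_simplicial[OF assms(1-3)] by blast
next
  case False
  then have "simplicial W E v" for v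
    by (auto simp: simplicial_def clique_def cadj_def)
  then show ?thesis using assms(4) by blast
qed

text \<open>Delete a simplicial vertex \<open>u\<close> with neighbourhood \<open>N\<close> and
  colour the rest with \<open>card K\<close> colours. If \<open>N\<close> has fewer than
  \<open>card K\<close> vertices, a colour is free for \<open>u\<close>; otherwise
  \<open>insert u N\<close> is a larger clique, which replaces \<open>K\<close> and pays for the
  fresh colour \<open>card N\<close>.\<close>

lemma chordal_colouring:
  assumes loop: "\<And>x. {x, x} \<notin> E" and "finite W" "chordal W E"
  shows "\<exists>K\<subseteq>W. clique K E \<and> (\<exists>c. proper_colouring W E (card K) c)"
  using assms(2-)
proof (induction W rule: finite_psubset_induct)
  case (psubset W)
  show ?case
  proof (cases "W = {}")
    case True
    then show ?thesis by (auto simp: proper_colouring_def clique_def)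
  next
    case False
    then obtain u where u: "u \<in> W" "simplicial W E u"
      using chordal_simplicial[OF loop psubset.hyps psubset.prems] by blast
    define N where "N = {x \<in> W. {u, x} \<in> E}"
    have uN: "u \<notin> N" using loop by (auto simp: N_def)
    obtain K c where K: "K \<subseteq> W - {u}" "clique K E" "proper_colouring (W - {u}) E (card K) c"
      using psubset.IH[of "W - {u}"] u chordal_mono[OF psubset.prems, of "W - {u}"] by blast
    have ext: "proper_colouring W E k (c(u := q))" if "card K \<le> k" "q < k" "q \<notin> c ` N" for k q
    proof -
      have "c x \<noteq> q" if "x \<in> W" "{u, x} \<in> E" for x
        using that \<open>q \<notin> c ` N\<close> by (auto simp: N_def)
      moreover have "c x < k" if "x \<in> W" "x \<noteq> u" for x
        using K(3) that \<open>card K \<le> k\<close> by (auto simp: proper_colouring_def Pi_def intro: less_le_trans)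
      moreover have "c x \<noteq> c y" if "x \<in> W" "x \<noteq> u" "y \<in> W" "y \<noteq> u" "{x, y} \<in> E" for x y
        using K(3) that by (auto simp: proper_colouring_def)
      moreover have "{x, u} \<in> E \<longleftrightarrow> {u, x} \<in> E" for x by (simp add: insert_commute)
      ultimately show ?thesis
        using \<open>q < k\<close> loop by (auto simp: proper_colouring_def Pi_def)
    qed
    have fN: "finite N" using psubset.hyps by (simp add: N_def)
    show ?thesis
    proof (cases "card N < card K")
      case True
      then have "card (c ` N) < card {..<card K}"
        using card_image_le[OF fN, of c] by simp
      then have "\<not> {..<card K} \<subseteq> c ` N"
        using fN by (meson card_mono finite_imageI linorder_not_less)
      then obtain q where "q < card K" "q \<notin> c ` N" by auto
      then show ?thesis using ext[of "card K" q] K by blast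
    next
      case False
      have "clique (insert u N) E"
        using u(2) by (auto simp: simplicial_def clique_def N_def insert_commute)
      moreover have "insert u N \<subseteq> W" using u by (auto simp: N_def)
      moreover have cc: "card (insert u N) = Suc (card N)" using fN uN by simp
      moreover have "card N \<notin> c ` N"
        using K(3) False uN unfolding proper_colouring_def N_def by fastforce
      then have "proper_colouring W E (card (insert u N)) (c(u := card N))"
        using False by (intro ext) (auto simp: cc)
      ultimately show ?thesis by blast
    qed
  qed
qed

section \<open>Rotations and neighbourhoods in a cycle\<close>

lemma near_Suc_mod:
  assumes "i < n" "j < n" "3 \<le> n"
  shows "near n (Suc i mod n) (Suc j mod n) \<longleftrightarrow> near n i j"
  using assms by (auto simp: near_def mod_Suc)

lemma near_rotate:
  assumes "i < n" "j < n" "3 \<le> n"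
  shows "near n ((i + r) mod n) ((j + r) mod n) \<longleftrightarrow> near n i j"
proof (induction r)
  case 0
  then show ?case using assms by simp
next
  case (Suc r)
  have "near n (Suc ((i + r) mod n) mod n) (Suc ((j + r) mod n) mod n) \<longleftrightarrow> near n i j"
    using near_Suc_mod[of "(i + r) mod n" n "(j + r) mod n"] Suc assms by simp
  then show ?case by (simp add: mod_Suc_eq)
qed

lemma bij_betw_rotate:
  fixes n :: nat
  shows "bij_betw (\<lambda>i. (i + r) mod n) {..<n} {..<n}"
proof (cases "n = 0")
  case False
  have "inj_on (\<lambda>i. (i + r) mod n) {..<n}"
  proof (rule inj_onI)
    fix i j assume ij: "i \<in> {..<n}" "j \<in> {..<n}" "(i + r) mod n = (j + r) mod n"
    \<comment> \<open>Shifting by \<open>s\<close> undoes the shift by \<open>r\<close>, since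
      \<open>r + s\<close> is a multiple of \<open>n\<close>.\<close>
    define s where "s = n - r mod n"
    have "(r + s) mod n = (r mod n + s) mod n" by (simp add: mod_add_left_eq)
    also have "r mod n + s = n" using False by (simp add: s_def less_imp_le)
    finally have rs: "(r + s) mod n = 0" by simp
    have undo: "((k + r) mod n + s) mod n = k mod n" for k
    proof -
      have "((k + r) mod n + s) mod n = (k + (r + s)) mod n"
        by (simp add: mod_add_left_eq add.assoc)
      also have "\<dots> = (k + (r + s) mod n) mod n" by (simp only: mod_add_right_eq)
      finally show ?thesis using rs by simp
    qed
    then have "i mod n = j mod n" using undo[of i] undo[of j] ij(3) by simp
    then show "i = j" using ij(1,2) by simp
  qed
  moreover have "(\<lambda>i. (i + r) mod n) ` {..<n} \<subseteq> {..<n}" using False by auto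
  ultimately show ?thesis
    by (simp add: bij_betw_def endo_inj_surj)
qed (simp add: bij_betw_def)

lemma rotate_surj:
  assumes "j < (n::nat)"
  obtains k where "k < n" "j = (k + r) mod n"
  using bij_betw_imp_surj_on[OF bij_betw_rotate[of r n]] assms by blast

text \<open>The positions \<open>i + 2\<close> and \<open>i + 3\<close> modulo \<open>n\<close> are
  two different non-neighbours of \<open>i\<close>, and \<open>q\<close> can be only one of them.
  The exception \<open>q\<close> is meant for a position whose hole vertex has been exchanged;
  \<open>q = n\<close> excludes nothing.\<close>

lemma near_not_all:
  assumes "5 \<le> n" "i < n"
  shows "\<exists>k<n. k \<noteq> q \<and> \<not> near n i k"
proof (rule ccontr)
  assume "\<not> ?thesis"
  then have *: "near n i k" if "k < n" "k \<noteq> q" for k using that by blast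
  define u where "u = (if i + 2 < n then i + 2 else i + 2 - n)"
  define w where "w = (if i + 3 < n then i + 3 else i + 3 - n)"
  have "u \<noteq> w" "u < n" "w < n" "\<not> near n i u" "\<not> near n i w"
    using assms by (auto simp: u_def w_def near_def)
  then show False using * by metis
qed

text \<open>The closed neighbourhoods of two different positions differ in at least two places, so
  one exception cannot hide the difference. Consecutive positions differ at the two outer
  neighbours, all other pairs at the two positions themselves.\<close>

lemma near_eq_except:
  assumes "5 \<le> n" "i < n" "j < n"
    and "\<And>k. k < n \<Longrightarrow> k \<noteq> q \<Longrightarrow> near n i k \<longleftrightarrow> near n j k"
  shows "i = j"
proof (rule ccontr)
  assume ne: "i \<noteq> j"
  have main: "\<exists>u w. u < n \<and> w < n \<and> u \<noteq> w \<and> near n i u \<noteq> near n j u \<and> near n i w \<noteq> near n j w"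
    if "i < j" "j < n" for i j
  proof (cases "j = Suc i")
    case True
    have "near n i (if i = 0 then n - 1 else i - 1) \<noteq> near n j (if i = 0 then n - 1 else i - 1)"
      "near n i (if Suc j = n then 0 else Suc j) \<noteq> near n j (if Suc j = n then 0 else Suc j)"
      "(if i = 0 then n - 1 else i - 1) \<noteq> (if Suc j = n then 0 else Suc j)"
      "(if i = 0 then n - 1 else i - 1) < n" "(if Suc j = n then 0 else Suc j) < n"
      using True that assms(1) by (auto simp: near_def split: if_splits)
    then show ?thesis by blast
  next
    case False
    show ?thesis
    proof (cases "i = 0 \<and> Suc j = n")
      case True
      have "near n i (j - 1) \<noteq> near n j (j - 1)" "near n i (Suc i) \<noteq> near n j (Suc i)"
        "j - 1 \<noteq> Suc i" "j - 1 < n" "Suc i < n"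
        using True that assms(1) by (auto simp: near_def)
      then show ?thesis by blast
    next
      case f2: False
      have "near n i i \<noteq> near n j i" "near n i j \<noteq> near n j j" "i < n" "j < n" "i \<noteq> j"
        using False f2 that by (auto simp: near_def)
      then show ?thesis by blast
    qed
  qed
  have "\<exists>u w. u < n \<and> w < n \<and> u \<noteq> w \<and> near n i u \<noteq> near n j u \<and> near n i w \<noteq> near n j w"
    using main[of i j] main[of j i] assms(2,3) ne by (metis linorder_neqE_nat)
  then show False using assms(4) by metis
qed

lemma hole_rotate:
  assumes "hole V E n f" "3 \<le> n"
  shows "hole V E n (\<lambda>i. f ((i + r) mod n))"
proof -
  have m: "(i + r) mod n < n" for i using assms(2) by simp
  have "inj_on (f \<circ> (\<lambda>i. (i + r) mod n)) {..<n}"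
    using assms(1) bij_betw_rotate[of r n] by (auto intro!: comp_inj_on simp: bij_betw_def hole_def)
  moreover have "f i \<in> V" if "i < n" for i
    using assms(1) that by (auto simp: hole_def)
  ultimately show ?thesis
    using assms near_rotate m by (auto simp: hole_def comp_def)
qed

lemma hole_edge:
  assumes "\<And>x. {x, x} \<notin> E" "hole V E n f" "i < n" "j < n"
  shows "{f i, f j} \<in> E \<longleftrightarrow> near n i j \<and> i \<noteq> j"
proof -
  have "f i = f j \<longleftrightarrow> i = j" using assms by (auto simp: hole_def inj_on_def)
  moreover have "cadj E (f i) (f j) \<longleftrightarrow> near n i j" using assms by (simp add: hole_def)
  ultimately show ?thesis using assms(1) by (auto simp: cadj_def)
qed

text \<open>By \<open>m + 2 \<le> n\<close> the arc from \<open>f 0\<close> to \<open>f m\<close>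
  omits at least one hole vertex, and is therefore an induced path.\<close>

lemma hole_arc:
  assumes "\<And>x. {x, x} \<notin> E" "hole V E n f" "2 \<le> m" "m + 2 \<le> n" "x \<in> V" "x \<notin> f ` {..<n}"
    and "\<And>i. i \<le> m \<Longrightarrow> {x, f i} \<in> E \<longleftrightarrow> i = 0 \<or> i = m"
  shows "hole V E (m + 2) (f(Suc m := x))"
proof (rule induced_path_hole)
  show "inj_on f {..m}" using assms(2,4) by (auto simp: hole_def inj_on_def)
  show "f ` {..m} \<subseteq> V" "x \<notin> f ` {..m}" using assms(2,4,6) by (auto simp: hole_def)
  show "{f i, f j} \<in> E \<longleftrightarrow> Suc i = j \<or> Suc j = i" if "i \<le> m" "j \<le> m" for i j
    using hole_edge[OF assms(1,2), of i j] that assms(4) by (auto simp: near_def)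
qed (use assms in auto)

section \<open>Structure of a graph with a hole of length \<open>2 * a + 1\<close>\<close>

text \<open>The parameter \<open>a\<close> will be the independence number. As
  \<open>2 * a + 1\<close> is odd, a hole on four vertices is contradictory, which is how several
  arguments below end.\<close>

locale long_hole_graph =
  fixes V :: "'a set" and E :: "'a set set" and a :: nat
  assumes graph: "simple_graph V E" and a2: "2 \<le> a"
    and indep_le: "\<And>S. S \<subseteq> V \<Longrightarrow> indep S E \<Longrightarrow> card S \<le> a"
    and hole_length: "\<And>n f. hole V E n f \<Longrightarrow> 4 \<le> n \<Longrightarrow> n = 2 * a + 1"
begin

lemmas loop = no_loop[OF graph]

text \<open>The vertices at the odd positions 1, 3, ..., \<open>n - 2\<close> are \<open>a\<close>
  independent vertices, so \<open>x\<close> must be adjacent to one of them. Excluding the positions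
  0 and \<open>n - 1\<close> later keeps an arc shorter than the whole hole.\<close>

lemma arc_neighbour:
  assumes h: "hole V E n f" "4 \<le> n" and x: "x \<in> V" "x \<notin> f ` {..<n}"
  shows "\<exists>j. 1 \<le> j \<and> j + 2 \<le> n \<and> {x, f j} \<in> E"
proof (rule ccontr)
  assume none: "\<not> ?thesis"
  have n: "n = 2 * a + 1" using hole_length h .
  define T where "T = (\<lambda>k. f (2 * k + 1)) ` {..<a}"
  have "inj_on (\<lambda>k. f (2 * k + 1)) {..<a}"
  proof (rule inj_onI)
    fix k l assume "k \<in> {..<a}" "l \<in> {..<a}" "f (2 * k + 1) = f (2 * l + 1)"
    then have "2 * k + 1 = 2 * l + 1"
      using h(1) n unfolding hole_def by (intro inj_onD[of f "{..<n}"]) auto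
    then show "k = l" by simp
  qed
  then have cT: "card T = a" by (simp add: T_def card_image)
  have TV: "T \<subseteq> f ` {..<n}" using n by (auto simp: T_def)
  moreover have "f ` {..<n} \<subseteq> V" using h by (simp add: hole_def)
  ultimately have "insert x T \<subseteq> V" using x(1) by auto
  moreover have "indep (insert x T) E"
  proof -
    have xT: "{x, t} \<notin> E" if "t \<in> T" for t
      using none that n by (auto simp: T_def)
    have "{f (2 * k + 1), f (2 * l + 1)} \<notin> E" if "k < a" "l < a" for k l
      using hole_edge[OF loop h(1), of "2 * k + 1" "2 * l + 1"] that n
      by (auto simp: near_def)
    then have "{s, t} \<notin> E" if "s \<in> T" "t \<in> T" for s t
      using that by (auto simp: T_def)
    then show ?thesis
      using xT loop by (auto simp: indep_def insert_commute)
  qed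
  ultimately have "card (insert x T) \<le> a" by (rule indep_le)
  moreover have "card (insert x T) = Suc a"
    using cT TV x(2) by (subst card_insert_disjoint) (auto simp: T_def)
  ultimately show False by simp
qed

text \<open>Let \<open>d\<close> be the first neighbour position after 0. The arc up to
  \<open>f d\<close> and \<open>x\<close> form a hole of length \<open>d + 2\<close>, which must be
  \<open>n\<close>. Hence \<open>d = n - 2\<close>, and position \<open>n - 1\<close> between the
  neighbours \<open>n - 2\<close> and 0 is a neighbour too, since otherwise a hole on four vertices
  arises.\<close>

lemma gap_neighbours:
  assumes h: "hole V E n f" "4 \<le> n" and x: "x \<in> V" "x \<notin> f ` {..<n}"
    and "{x, f 0} \<in> E" "{x, f 1} \<notin> E" "j < n"
  shows "{x, f j} \<in> E \<longleftrightarrow> near n (n - 1) j"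
proof -
  have n: "n = 2 * a + 1" using hole_length h .
  define d where "d = (LEAST d. 1 \<le> d \<and> {x, f d} \<in> E)"
  obtain k where k: "1 \<le> k" "k + 2 \<le> n" "{x, f k} \<in> E"
    using arc_neighbour[OF h x] by blast
  have d: "1 \<le> d \<and> {x, f d} \<in> E" unfolding d_def by (rule LeastI[of _ k]) (use k in auto)
  have dk: "d \<le> k" unfolding d_def by (rule Least_le) (use k in auto)
  have below: "{x, f i} \<notin> E" if "1 \<le> i" "i < d" for i
    using not_less_Least[of i "\<lambda>d. 1 \<le> d \<and> {x, f d} \<in> E"] that unfolding d_def by blast
  have d2: "2 \<le> d" using d assms(6) by (cases "d = 1") auto
  have "hole V E (d + 2) (f(Suc d := x))"
  proof (rule hole_arc[OF loop h(1) d2 _ x])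
    show "{x, f i} \<in> E \<longleftrightarrow> i = 0 \<or> i = d" if "i \<le> d" for i
      using below[of i] that d assms(5) by (cases "i = 0 \<or> i = d") auto
  qed (use dk k in auto)
  then have dn: "d + 2 = n" using hole_length[of "d + 2"] d2 n by simp
  have last: "{x, f (n - 1)} \<in> E"
  proof (rule ccontr)
    assume c: "{x, f (n - 1)} \<notin> E"
    \<comment> \<open>Rotation by \<open>d = n - 2\<close> moves the arc \<open>f (n - 2)\<close>,
      \<open>f (n - 1)\<close>, \<open>f 0\<close> to the positions 0, 1, 2.\<close>
    define g where "g = (\<lambda>i. f ((i + d) mod n))"
    have g: "g 0 = f d" "g 1 = f (n - 1)" "g 2 = f 0"
      using dn by (auto simp: g_def add.commute)
    have hg: "hole V E n g" unfolding g_def using h by (intro hole_rotate) auto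
    have "hole V E (2 + 2) (g(Suc 2 := x))"
    proof (rule hole_arc[OF loop hg _ _ x(1)])
      show "x \<notin> g ` {..<n}" using x(2) h(2) by (auto simp: g_def)
      fix i :: nat assume "i \<le> 2"
      then have "i = 0 \<or> i = 1 \<or> i = 2" by auto
      then show "{x, g i} \<in> E \<longleftrightarrow> i = 0 \<or> i = 2" using g c d assms(5) by auto
    qed (use h in auto)
    from hole_length[OF this] show False by presburger
  qed
  have "j = 0 \<or> (1 \<le> j \<and> j < d) \<or> j = d \<or> j = n - 1" using assms(7) dn by auto
  then show ?thesis
    using below[of j] d d2 last assms(5) dn by (auto simp: near_def)
qed

text \<open>If \<open>x\<close> sees some \<open>f r\<close> but not its successor, rotating by
  \<open>r\<close> gives the situation of \<open>gap_neighbours\<close>. Otherwise adjacency passes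
  from each position to the next, and a single neighbour makes \<open>x\<close> complete to the
  hole.\<close>

lemma vertex_types:
  assumes h: "hole V E n f" "4 \<le> n" and x: "x \<in> V"
  shows "(\<forall>j<n. cadj E x (f j)) \<or> (\<exists>i<n. \<forall>j<n. cadj E x (f j) \<longleftrightarrow> near n i j)"
proof (cases "x \<in> f ` {..<n}")
  case True
  then show ?thesis using h(1) by (auto simp: hole_def)
next
  case False
  have cad: "cadj E x (f j) \<longleftrightarrow> {x, f j} \<in> E" if "j < n" for j
    using False that by (auto simp: cadj_def)
  show ?thesis
  proof (cases "\<exists>i<n. {x, f i} \<in> E \<and> {x, f (Suc i mod n)} \<notin> E")
    case True
    then obtain r where r: "r < n" "{x, f r} \<in> E" "{x, f (Suc r mod n)} \<notin> E" by blast
    define g where "g = (\<lambda>i. f ((i + r) mod n))"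
    have hg: "hole V E n g" unfolding g_def using h by (intro hole_rotate) auto
    have xg: "x \<notin> g ` {..<n}" using False h(2) by (auto simp: g_def)
    have gn: "{x, g j} \<in> E \<longleftrightarrow> near n (n - 1) j" if "j < n" for j
      by (rule gap_neighbours[OF hg h(2) x xg _ _ that]) (use r in \<open>auto simp: g_def\<close>)
    have "{x, f j} \<in> E \<longleftrightarrow> near n ((n - 1 + r) mod n) j" if j: "j < n" for j
    proof -
      obtain k where k: "k < n" "j = (k + r) mod n" using rotate_surj[OF j] .
      then show ?thesis
        using gn[of k] near_rotate[of "n - 1" n k r] h(2) by (simp add: g_def)
    qed
    moreover have "(n - 1 + r) mod n < n" using h(2) by simp
    ultimately show ?thesis using cad by blast
  next
    case F: False
    obtain k where "k + 2 \<le> n" and k2: "{x, f k} \<in> E"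
      using arc_neighbour[OF h x False] by blast
    then have k: "k < n" "{x, f k} \<in> E" by auto
    have "{x, f ((k + r) mod n)} \<in> E" for r
    proof (induction r)
      case (Suc r)
      then have "{x, f (Suc ((k + r) mod n) mod n)} \<in> E" using F k by auto
      then show ?case by (simp add: mod_Suc_eq)
    qed (use k in simp)
    then have "{x, f j} \<in> E" if j: "j < n" for j
      using rotate_surj[OF j, of k] by (metis add.commute)
    then show ?thesis using cad by blast
  qed
qed

lemma hole_replace:
  assumes h: "hole V E n f" "5 \<le> n" and x: "x \<in> V" and "i < n"
    and t: "\<And>j. j < n \<Longrightarrow> cadj E x (f j) \<longleftrightarrow> near n i j"
  shows "hole V E n (f(i := x))"
proof -
  have ad: "cadj E (f j) (f k) \<longleftrightarrow> near n j k" if "j < n" "k < n" for j k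
    using h(1) that by (simp add: hole_def)
  \<comment> \<open>If \<open>x\<close> were the hole vertex \<open>f j\<close>, the positions
    \<open>i\<close> and \<open>j\<close> would have equal neighbourhoods.\<close>
  have new: "x \<noteq> f j" if j: "j < n" "j \<noteq> i" for j
  proof
    assume "x = f j"
    then have "i = j" using near_eq_except[OF h(2) assms(4) j(1), of n] t ad j by simp
    then show False using j by simp
  qed
  show ?thesis
    unfolding hole_def
  proof (intro conjI allI impI)
    show "inj_on (f(i := x)) {..<n}"
      using h(1) new by (fastforce simp: hole_def inj_on_def)
    show "(f(i := x)) ` {..<n} \<subseteq> V" using h(1) x by (auto simp: hole_def)
    fix j k assume "j < n" "k < n"
    then show "cadj E ((f(i := x)) j) ((f(i := x)) k) \<longleftrightarrow> near n j k"
      using ad t cadj_sym[of E x] near_sym[of n i] by (auto simp: cadj_def near_def)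
  qed
qed

lemma hole_cycle_blowup:
  assumes h: "hole V E n f" "4 \<le> n"
  shows "\<exists>D A. cycle_blowup V E n D A"
proof -
  have n5: "5 \<le> n" using hole_length[OF h] a2 by simp
  define D where "D = {x \<in> V. \<forall>j<n. cadj E x (f j)}"
  define A where "A = (\<lambda>i. {x \<in> V. \<forall>j<n. cadj E x (f j) \<longleftrightarrow> near n i j})"
  have rep: "hole V E n (f(i := x))" if "x \<in> A i" "i < n" for x i
    using hole_replace[OF h(1) n5, of x i] that by (simp add: A_def)
  \<comment> \<open>After \<open>f i\<close> is exchanged for \<open>x\<close>, classify
    \<open>y\<close> against the new hole. Its adjacency at the positions other than
    \<open>i\<close> is unchanged, which already forces type \<open>j\<close>; position
    \<open>i\<close> then decides the adjacency of \<open>x\<close> and \<open>y\<close>.\<close>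
  have AA: "cadj E x y \<longleftrightarrow> near n i j"
    if i: "i < n" and j: "j < n" and x: "x \<in> A i" and y: "y \<in> A j" for i j x y
  proof -
    let ?g = "f(i := x)"
    have yk: "cadj E y (?g k) \<longleftrightarrow> near n j k" if "k < n" "k \<noteq> i" for k
      using y that by (simp add: A_def)
    obtain k where "k < n" "k \<noteq> i" "\<not> near n j k" using near_not_all[OF n5 j] by blast
    then have "\<not> (\<forall>k<n. cadj E y (?g k))" using yk by blast
    then obtain q where q: "q < n" "\<forall>k<n. cadj E y (?g k) \<longleftrightarrow> near n q k"
      using vertex_types[OF rep[OF x i] h(2), of y] y by (auto simp: A_def)
    have "q = j" by (rule near_eq_except[OF n5 q(1) j, of i]) (use q yk in blast)
    then have "cadj E y (?g i) \<longleftrightarrow> near n j i" using q i by blast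
    then show ?thesis using cadj_sym[of E x y] near_sym[of n i j] by simp
  qed
  \<comment> \<open>The same exchange: \<open>x\<close> sees all positions but possibly one, too
    many for a cyclic type, so it sees the new vertex \<open>y\<close> as well.\<close>
  have DA: "cadj E x y" if i: "i < n" and x: "x \<in> D" and y: "y \<in> A i" for i x y
  proof -
    let ?g = "f(i := y)"
    have xk: "cadj E x (?g k)" if "k < n" "k \<noteq> i" for k
      using x that by (simp add: D_def)
    have "\<not> (\<exists>q<n. \<forall>k<n. cadj E x (?g k) \<longleftrightarrow> near n q k)"
      using xk near_not_all[OF n5, of _ i] by blast
    then have "\<forall>k<n. cadj E x (?g k)"
      using vertex_types[OF rep[OF y i] h(2), of x] x by (auto simp: D_def)
    then show ?thesis using i by (metis fun_upd_same)
  qed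
  have f02: "{f 0, f 2} \<notin> E"
    using hole_edge[OF loop h(1), of 0 2] n5 by (auto simp: near_def)
  have f02': "f 0 \<noteq> f 2"
    using h(1) n5 inj_on_eq_iff[of f "{..<n}" 0 2] by (simp add: hole_def)
  \<comment> \<open>Otherwise \<open>x\<close>, \<open>f 0\<close>, \<open>y\<close>,
    \<open>f 2\<close> would be a hole on four vertices.\<close>
  have DD: "cadj E x y" if x: "x \<in> D" and y: "y \<in> D" for x y
  proof (rule ccontr)
    assume nxy: "\<not> cadj E x y"
    have ad: "cadj E x (f 0)" "cadj E x (f 2)" "cadj E y (f 0)" "cadj E y (f 2)"
      using x y n5 by (auto simp: D_def)
    then have ne: "x \<noteq> f 0" "x \<noteq> f 2" "y \<noteq> f 0" "y \<noteq> f 2" "x \<noteq> y" "{x, y} \<notin> E"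
      using nxy cadj_sym[of E] by (auto simp: cadj_def)
    then have e: "{x, f 0} \<in> E" "{x, f 2} \<in> E" "{y, f 0} \<in> E" "{y, f 2} \<in> E"
      using ad by (auto simp: cadj_def)
    define p where "p = (\<lambda>i::nat. if i = 0 then x else if i = 1 then f 0 else y)"
    have s: "{..2} = {0, 1, 2::nat}" by auto
    have c: "i = 0 \<or> i = 1 \<or> i = 2" if "i \<le> 2" for i :: nat using that by auto
    have "hole V E (2 + 2) (p(Suc 2 := f 2))"
    proof (rule induced_path_hole)
      show "inj_on p {..2}" unfolding s using ne by (auto simp: p_def)
      show "p ` {..2} \<subseteq> V" "f 2 \<in> V" using x y h n5 by (auto simp: p_def D_def hole_def)
      show "f 2 \<notin> p ` {..2}" unfolding s using ne f02' by (auto simp: p_def)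
      show "{p i, p j} \<in> E \<longleftrightarrow> Suc i = j \<or> Suc j = i" if "i \<le> 2" "j \<le> 2" for i j
        using c[OF that(1)] c[OF that(2)] e ne loop by (auto simp: p_def insert_commute)
      show "{f 2, p i} \<in> E \<longleftrightarrow> i = 0 \<or> i = 2" if "i \<le> 2" for i
        using c[OF that] e ne f02 by (auto simp: p_def insert_commute)
    qed simp
    from hole_length[OF this] show False by presburger
  qed
  have "V = D \<union> (\<Union>i<n. A i)"
    using vertex_types[OF h] by (auto simp: D_def A_def)
  moreover have "A i \<inter> A j = {}" if "i < n" "j < n" "i \<noteq> j" for i j
    using near_eq_except[OF n5 that(1,2), of n] that(3) by (fastforce simp: A_def)
  moreover have "D \<inter> A i = {}" if "i < n" for i
    using near_not_all[OF n5 that, of n] by (auto simp: D_def A_def)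
  ultimately have "cycle_blowup V E n D A"
    unfolding cycle_blowup_def using AA DA DD by blast
  then show ?thesis by blast
qed

end

section \<open>Odd clique minors whose trees are paths\<close>

text \<open>For acyclicity, consider the vertex of a supposed cycle that lies furthest along the
  path: both its neighbours on the cycle would have to be its one predecessor on the path.\<close>

lemma path_is_tree:
  assumes "0 < l" "inj_on p {..<l}"
  shows "is_tree (p ` {..<l}) {{p i, p (Suc i)} |i. Suc i < l}"
proof -
  let ?F = "{{p i, p (Suc i)} |i. Suc i < l}"
  have "{p i, p (Suc i)} \<in> nsets (p ` {..<l}) 2" if "Suc i < l" for i
  proof -
    have "p i \<noteq> p (Suc i)" using inj_onD[OF assms(2), of i "Suc i"] that by auto
    then show ?thesis using that by (auto simp: nsets_def)
  qed
  then have "simple_graph (p ` {..<l}) ?F" by (auto simp: simple_graph_def)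
  moreover have "graph_connected (p ` {..<l}) ?F"
  proof -
    let ?R = "{(x, y). {x, y} \<in> ?F}"
    have 0: "(p 0, p i) \<in> ?R\<^sup>*" if "i < l" for i
      using that
    proof (induction i)
      case (Suc i)
      then have "(p i, p (Suc i)) \<in> ?R" by blast
      then show ?case using Suc by (meson Suc_lessD rtrancl_into_rtrancl)
    qed simp
    have "sym ?R" by (auto simp: sym_def insert_commute)
    then have "(p i, p j) \<in> ?R\<^sup>*" if "i < l" "j < l" for i j
      using 0[OF that(1)] 0[OF that(2)] by (meson sym_rtrancl symD rtrancl_trans)
    then show ?thesis using assms(1) by (auto simp: graph_connected_def)
  qed
  moreover have "\<not> is_cycle ?F xs" for xs
  proof
    assume "is_cycle ?F xs"
    then have len: "3 \<le> length xs" and dist: "distinct xs"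
      and e: "\<And>i. i < length xs \<Longrightarrow> {xs ! i, xs ! (Suc i mod length xs)} \<in> ?F"
      by (auto simp: is_cycle_def)
    define k where "k = length xs"
    define pos where "pos = the_inv_into {..<l} p"
    have pp: "pos (p i) = i" if "i < l" for i
      unfolding pos_def using the_inv_into_f_f[OF assms(2)] that by simp
    have consec: "Suc (pos x) = pos y \<or> Suc (pos y) = pos x" if xy: "{x, y} \<in> ?F" for x y
    proof -
      obtain i where "{x, y} = {p i, p (Suc i)}" "Suc i < l" using xy by blast
      then show ?thesis using pp[of i] pp[of "Suc i"] by (auto simp: doubleton_eq_iff)
    qed
    have inp: "x \<in> p ` {..<l}" if xy: "{x, y} \<in> ?F" for x y
    proof -
      obtain i where "{x, y} = {p i, p (Suc i)}" "Suc i < l" using xy by blast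
      then show ?thesis by (auto simp: doubleton_eq_iff)
    qed
    have inj: "i = j" if "i < k" "j < k" "pos (xs ! i) = pos (xs ! j)" for i j
    proof -
      have "xs ! i \<in> p ` {..<l}" "xs ! j \<in> p ` {..<l}"
        using inp[OF e, of i] inp[OF e, of j] that unfolding k_def by simp_all
      then have "p (pos (xs ! i)) = xs ! i" "p (pos (xs ! j)) = xs ! j"
        unfolding pos_def using assms(2) by (simp_all add: f_the_inv_into_f)
      then have "xs ! i = xs ! j" using that(3) by metis
      then show ?thesis using dist that by (simp add: k_def nth_eq_iff_index_eq)
    qed
    have ne: "{..<k} \<noteq> {}" using len by (auto simp: k_def lessThan_empty_iff)
    then obtain m where m: "m < k" "\<And>i. i < k \<Longrightarrow> pos (xs ! i) \<le> pos (xs ! m)"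
      using obtains_MAX[of "{..<k}" "\<lambda>i. pos (xs ! i)"]
      by (metis Max_ge finite_imageI finite_lessThan imageI lessThan_iff)
    define u where "u = Suc m mod k"
    define w where "w = (if m = 0 then k - 1 else m - 1)"
    have uw: "u < k" "w < k" "u \<noteq> w" "Suc w mod k = m" "u \<noteq> m" "w \<noteq> m"
      using m(1) len unfolding u_def w_def k_def[symmetric] by (auto simp: mod_Suc)
    have "Suc (pos (xs ! u)) = pos (xs ! m)"
      using consec[OF e[of m]] m(1) m(2)[OF uw(1)] unfolding u_def k_def by linarith
    moreover have "Suc (pos (xs ! w)) = pos (xs ! m)"
      using consec[OF e[of w]] m(2)[OF uw(2)] uw(2,4) unfolding k_def by auto
    ultimately show False using inj[of u w] uw by simp
  qed
  ultimately show ?thesis by (auto simp: is_tree_def)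
qed

text \<open>The index type is free, so that trees can be labelled by vertices of the graph. The
  single injectivity assumption makes each path simple and different paths disjoint.\<close>

lemma odd_clique_minor_of_paths:
  fixes P :: "'i \<Rightarrow> nat \<Rightarrow> 'a"
  assumes "finite I" "\<And>x. x \<in> I \<Longrightarrow> 0 < L x"
    and V: "\<And>x i. x \<in> I \<Longrightarrow> i < L x \<Longrightarrow> P x i \<in> V"
    and inj: "\<And>x y i j. x \<in> I \<Longrightarrow> y \<in> I \<Longrightarrow> i < L x \<Longrightarrow> j < L y \<Longrightarrow> P x i = P y j \<Longrightarrow> x = y \<and> i = j"
    and edge: "\<And>x i. x \<in> I \<Longrightarrow> Suc i < L x \<Longrightarrow>
      {P x i, P x (Suc i)} \<in> E \<and> c (P x i) \<noteq> (c (P x (Suc i)) :: bool)"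
    and joined: "\<And>x y. x \<in> I \<Longrightarrow> y \<in> I \<Longrightarrow> x \<noteq> y \<Longrightarrow>
      \<exists>i<L x. \<exists>j<L y. {P x i, P y j} \<in> E \<and> c (P x i) = c (P y j)"
  shows "has_odd_clique_minor V E (card I)"
proof -
  obtain h where h: "bij_betw h {..<card I} I"
    using ex_bij_betw_nat_finite[OF assms(1)] by (auto simp: atLeast0LessThan)
  have hI: "h i \<in> I" if "i < card I" for i using h that by (auto simp: bij_betw_def)
  have hne: "h i \<noteq> h j" if "i < card I" "j < card I" "i \<noteq> j" for i j
    using h that by (auto simp: bij_betw_def inj_on_def)
  define T where "T = (\<lambda>i. P (h i) ` {..<L (h i)})"
  define F where "F = (\<lambda>i. {{P (h i) j, P (h i) (Suc j)} |j. Suc j < L (h i)})"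
  have "T i \<subseteq> V \<and> F i \<subseteq> E \<and> is_tree (T i) (F i)" if i: "i < card I" for i
  proof (intro conjI)
    show "T i \<subseteq> V" "F i \<subseteq> E" using V edge hI[OF i] by (auto simp: T_def F_def)
    have "inj_on (P (h i)) {..<L (h i)}" using inj hI[OF i] by (auto simp: inj_on_def)
    then show "is_tree (T i) (F i)"
      unfolding T_def F_def using assms(2)[OF hI[OF i]] by (intro path_is_tree)
  qed
  moreover have "disjoint_family_on T {..<card I}"
    unfolding disjoint_family_on_def
  proof (intro ballI impI)
    fix i j assume ij: "i \<in> {..<card I}" "j \<in> {..<card I}" "i \<noteq> j"
    then show "T i \<inter> T j = {}"
      using inj[OF hI hI, of i j] hne[of i j] by (auto simp: T_def)
  qed
  moreover have "c u \<noteq> c v" if i: "i < card I" and uv: "{u, v} \<in> F i" for i u v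
  proof -
    obtain j where "{u, v} = {P (h i) j, P (h i) (Suc j)}" "Suc j < L (h i)"
      using uv by (auto simp: F_def)
    then show ?thesis using edge[OF hI[OF i], of j] by (auto simp: doubleton_eq_iff)
  qed
  moreover have "\<exists>u\<in>T i. \<exists>v\<in>T j. {u, v} \<in> E \<and> c u = c v"
    if "i < card I" "j < card I" "i \<noteq> j" for i j
    using joined[OF hI hI hne, OF that(1,2) that] by (auto simp: T_def)
  ultimately show ?thesis
    unfolding has_odd_clique_minor_def
    by (intro exI[of _ T] exI[of _ F] exI[of _ c] conjI allI impI) blast+
qed

lemma clique_odd_minor:
  assumes "finite K" "K \<subseteq> V" "clique K E"
  shows "has_odd_clique_minor V E (card K)"
  by (rule odd_clique_minor_of_paths[where L = "\<lambda>_. 1" and P = "\<lambda>x _. x" and c = "\<lambda>_. True"])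
    (use assms in \<open>auto simp: clique_def\<close>)

section \<open>Colourings and odd minors of blown-up cycles\<close>

text \<open>This allows the two bounds below to be stated with their distinguished parts at the
  indices 0 and 1.\<close>

lemma cycle_blowup_rotate:
  assumes "cycle_blowup V E n D A" "3 \<le> n"
  shows "cycle_blowup V E n D (\<lambda>i. A ((i + r) mod n))"
proof -
  have m: "(i + r) mod n < n" for i using assms(2) by simp
  have inj: "(i + r) mod n \<noteq> (j + r) mod n" if "i < n" "j < n" "i \<noteq> j" for i j
    using inj_onD[OF bij_betw_imp_inj_on[OF bij_betw_rotate[of r n]], of i j] that by auto
  have "(\<Union>i<n. A ((i + r) mod n)) = \<Union> (A ` ((\<lambda>i. (i + r) mod n) ` {..<n}))"
    by (simp add: image_image)
  also have "\<dots> = (\<Union>i<n. A i)"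
    using bij_betw_imp_surj_on[OF bij_betw_rotate[of r n]] by simp
  finally have u: "(\<Union>i<n. A ((i + r) mod n)) = (\<Union>i<n. A i)" .
  have "cadj E x y \<longleftrightarrow> near n i j"
    if "i < n" "j < n" "x \<in> A ((i + r) mod n)" "y \<in> A ((j + r) mod n)" for i j x y
    using assms(1) m[of i] m[of j] that near_rotate[OF that(1,2) assms(2), of r]
    unfolding cycle_blowup_def by blast
  then show ?thesis
    using assms(1) m inj unfolding cycle_blowup_def u by simp
qed

text \<open>One part is coloured with private colours; along the remaining path of cliques the
  colours are used alternately from below and from above.\<close>

lemma cycle_blowup_colouring:
  assumes g: "simple_graph V E" and b: "cycle_blowup V E n D A" and n: "3 \<le> n"
    and W: "\<And>i. Suc i < n \<Longrightarrow> card (A i) + card (A (Suc i)) \<le> W"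
  shows "\<exists>c. proper_colouring V E (card D + card (A 0) + W) c"
proof -
  have V: "V = D \<union> (\<Union>i<n. A i)"
    and disj: "\<And>i j x. i < n \<Longrightarrow> j < n \<Longrightarrow> x \<in> A i \<Longrightarrow> x \<in> A j \<Longrightarrow> i = j"
    and DA: "\<And>i x. i < n \<Longrightarrow> x \<in> D \<Longrightarrow> x \<in> A i \<Longrightarrow> False"
    and ad: "\<And>i j x y. i < n \<Longrightarrow> j < n \<Longrightarrow> x \<in> A i \<Longrightarrow> y \<in> A j \<Longrightarrow> cadj E x y \<longleftrightarrow> near n i j"
    using b unfolding cycle_blowup_def by blast+
  have fV: "finite V" using g by (simp add: simple_graph_def)
  have fA: "finite (A i)" if "i < n" for i
    using fV that by (auto intro: finite_subset simp: V)
  have fD: "finite D" using fV by (auto intro: finite_subset simp: V)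
  have "\<exists>e. bij_betw e (A i) {0..<card (A i)}" if "i < n" for i
    using ex_bij_betw_finite_nat[OF fA[OF that]] .
  then obtain e where e: "\<And>i. i < n \<Longrightarrow> bij_betw (e i) (A i) {0..<card (A i)}" by metis
  obtain d where d: "bij_betw d D {0..<card D}" using ex_bij_betw_finite_nat[OF fD] by blast
  have elt: "e i x < card (A i)" if "i < n" "x \<in> A i" for i x
    using e[OF that(1)] that(2) by (auto simp: bij_betw_def)
  have einj: "x = y" if "i < n" "x \<in> A i" "y \<in> A i" "e i x = e i y" for i x y
    using e[OF that(1)] that by (auto simp: bij_betw_def inj_on_def)
  have dlt: "d x < card D" if "x \<in> D" for x
    using d that by (auto simp: bij_betw_def)
  have dinj: "x = y" if "x \<in> D" "y \<in> D" "d x = d y" for x y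
    using d that by (auto simp: bij_betw_def inj_on_def)
  define ix where "ix x = (THE i. i < n \<and> x \<in> A i)" for x
  have ix: "ix x = i" if "i < n" "x \<in> A i" for x i
    unfolding ix_def using that disj by blast
  \<comment> \<open>\<open>A 0\<close> gets the private colours from \<open>W\<close> on. Odd parts
    count upwards from 0 and even ones downwards from \<open>W - 1\<close>; two consecutive parts
    have at most \<open>W\<close> vertices together, so their colours do not meet. Every part has at
    most \<open>W\<close> vertices, so the subtraction is not truncated.\<close>
  define q where "q i x = (if i = 0 then W + e i x else if odd i then e i x else W - 1 - e i x)" for i x
  define c where "c x = (if x \<in> D then W + card (A 0) + d x else q (ix x) x)" for x
  have cA: "c x = q i x" if "i < n" "x \<in> A i" for i x
    using that DA ix by (auto simp: c_def)
  have cW: "card (A i) \<le> W" if "i < n" for i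
    using W[of i] W[of "i - 1"] that n by (cases "Suc i < n"; cases i) auto
  have qlt: "q i x < (if i = 0 then W + card (A 0) else W)" if "i < n" "x \<in> A i" for i x
    using elt[OF that] cW[OF that(1)] by (auto simp: q_def)
  have q0: "W \<le> q 0 x" for x by (simp add: q_def)
  have qne: "q i x \<noteq> q j y"
    if ij: "i < n" "j < n" "x \<in> A i" "y \<in> A j" "x \<noteq> y" "near n i j" "i \<le> j" for i j x y
  proof -
    \<comment> \<open>The wrap-around pair of positions 0 and \<open>n - 1\<close> falls under the
      private colours of \<open>i = 0\<close>.\<close>
    consider "i = j" | "i = 0" "j \<noteq> 0" | "i \<noteq> 0" "j = Suc i"
      using ij(6,7) by (auto simp: near_def)
    then show ?thesis
    proof cases
      case 1
      then have "e i x \<noteq> e i y" using einj ij by blast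
      then show ?thesis using 1 elt[OF ij(1,3)] elt[of i y] ij cW[OF ij(1)] by (auto simp: q_def)
    next
      case 2
      then show ?thesis using q0[of x] qlt[OF ij(2,4)] by auto
    next
      case 3
      then show ?thesis
        using elt[OF ij(1,3)] elt[OF ij(2,4)] W[of i] ij(2) by (auto simp: q_def)
    qed
  qed
  have "proper_colouring V E (card D + card (A 0) + W) c"
    unfolding proper_colouring_def
  proof (intro conjI ballI impI)
    have lt: "c x < W + card (A 0)" if "i < n" "x \<in> A i" for i x
      using cA[OF that] qlt[OF that] by (auto split: if_splits)
    have Dc: "c x = W + card (A 0) + d x" if "x \<in> D" for x using that by (simp add: c_def)
    show "c \<in> V \<rightarrow> {..<card D + card (A 0) + W}"
    proof
      fix x assume "x \<in> V"
      then consider "x \<in> D" | i where "i < n" "x \<in> A i" by (auto simp: V)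
      then show "c x \<in> {..<card D + card (A 0) + W}"
        by cases (use lt Dc dlt in fastforce)+
    qed
    fix x y assume x: "x \<in> V" and y: "y \<in> V" and xy: "{x, y} \<in> E"
    have ne: "x \<noteq> y" using xy no_loop[OF g] by auto
    consider "x \<in> D" "y \<in> D" | i where "i < n" "x \<in> A i" "y \<in> D"
      | i where "x \<in> D" "i < n" "y \<in> A i"
      | i j where "i < n" "x \<in> A i" "j < n" "y \<in> A j"
      using x y by (auto simp: V)
    then show "c x \<noteq> c y"
    proof cases
      case 1
      then show ?thesis using Dc dinj ne by fastforce
    next
      case 2
      then show ?thesis using lt[of i x] Dc[of y] by simp
    next
      case 3
      then show ?thesis using lt[of i y] Dc[of x] by simp
    next
      case 4
      have "near n i j" using ad[OF 4(1,3,2,4)] xy by (simp add: cadj_def)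
      then show ?thesis
        using qne[OF 4(1,3,2,4) ne] qne[OF 4(3,1,4,2)] ne near_sym[of n i j] cA 4
        by (metis nat_le_linear)
    qed
  qed
  then show ?thesis by blast
qed

text \<open>Two consecutive parts and the dominating vertices form a clique of trivial trees; the other
  parts are traversed by \<open>m\<close> disjoint paths on the odd number \<open>n - 2\<close> of vertices, so that both
  ends of each path receive the colour of the trivial trees.\<close>

lemma cycle_blowup_odd_minor:
  assumes g: "simple_graph V E" and b: "cycle_blowup V E n D A" and n: "5 \<le> n" "odd n"
    and m: "\<And>i. i < n \<Longrightarrow> m \<le> card (A i)"
  shows "has_odd_clique_minor V E (card D + (card (A 0) + card (A 1)) + m)"
proof -
  have V: "V = D \<union> (\<Union>i<n. A i)"
    and disj: "\<And>i j x. i < n \<Longrightarrow> j < n \<Longrightarrow> x \<in> A i \<Longrightarrow> x \<in> A j \<Longrightarrow> i = j"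
    and DA: "\<And>i x. i < n \<Longrightarrow> x \<in> D \<Longrightarrow> x \<in> A i \<Longrightarrow> False"
    and Dad: "\<And>x y. x \<in> D \<Longrightarrow> y \<in> V \<Longrightarrow> cadj E x y"
    and ad: "\<And>i j x y. i < n \<Longrightarrow> j < n \<Longrightarrow> x \<in> A i \<Longrightarrow> y \<in> A j \<Longrightarrow> cadj E x y \<longleftrightarrow> near n i j"
    using b unfolding cycle_blowup_def by blast+
  have fV: "finite V" using g by (simp add: simple_graph_def)
  have fA: "finite (A i)" if "i < n" for i
    using fV that by (auto intro: finite_subset simp: V)
  have fD: "finite D" using fV by (auto intro: finite_subset simp: V)
  \<comment> \<open>The elements of \<open>B\<close> only label the paths: the one labelled
    \<open>x\<close> visits \<open>h i x\<close> in each part \<open>A i\<close> with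
    \<open>2 \<le> i\<close>, and injectivity of \<open>h i\<close> keeps the paths
    disjoint.\<close>
  obtain B where B: "B \<subseteq> A 2" "card B = m" "finite B"
    using obtain_subset_with_card_n[OF m[of 2]] n by auto
  have "\<exists>h. inj_on h B \<and> h ` B \<subseteq> A i" if "i < n" for i
    using card_le_inj[OF B(3) fA[OF that]] m[OF that] B(2) by blast
  then obtain h where h: "\<And>i. i < n \<Longrightarrow> inj_on (h i) B \<and> h i ` B \<subseteq> A i" by metis
  define S where "S = D \<union> A 0 \<union> A 1"
  define P where "P x i = (if x \<in> B then h (i + 2) x else x)" for x i
  define L where "L x = (if x \<in> B then n - 2 else 1)" for x
  \<comment> \<open>Parts from index 2 on alternate by parity. The bound \<open>2 \<le> i\<close>
    leaves \<open>A 1\<close> with the colour of the trivial trees, and since \<open>n - 1\<close>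
    is even, \<open>A (n - 1)\<close> gets that colour too.\<close>
  define c where "c x \<longleftrightarrow> \<not> (\<exists>i<n. 2 \<le> i \<and> odd i \<and> x \<in> A i)" for x
  have SV: "S \<subseteq> V" using n by (auto simp: S_def V)
  have SA: False if "x \<in> S" "x \<in> A i" "2 \<le> i" "i < n" for x i
    using that disj[of 0 i x] disj[of 1 i x] DA[of i x] n by (auto simp: S_def)
  have SB: "x \<notin> B" if "x \<in> S" for x using SA[OF that, of 2] B n by auto
  have PB: "P x i \<in> A (i + 2)" if "x \<in> B" "i + 2 < n" for x i
    using h[OF that(2)] that(1) by (auto simp: P_def)
  have PS: "P x i = x" if "x \<in> S" for x i using SB[OF that] by (simp add: P_def)
  have cS: "c x" if "x \<in> S" for x using SA[OF that] by (auto simp: c_def)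
  have cA: "c x \<longleftrightarrow> even i" if "x \<in> A i" "2 \<le> i" "i < n" for x i
  proof -
    have "(\<exists>j<n. 2 \<le> j \<and> odd j \<and> x \<in> A j) \<longleftrightarrow> odd i"
      using that disj[OF _ that(3) _ that(1)] by blast
    then show ?thesis by (simp add: c_def)
  qed
  have cPB: "c (P x i) \<longleftrightarrow> even i" if "x \<in> B" "i + 2 < n" for x i
    using cA[OF PB[OF that]] that by simp
  have LB: "L x = n - 2" if "x \<in> B" for x using that by (simp add: L_def)
  have LS: "L x = 1" if "x \<in> S" for x using SB[OF that] by (simp add: L_def)
  have SS: "cadj E x y" if "x \<in> S" "y \<in> S" for x y
  proof -
    have "cadj E x y" if "x \<in> A i" "y \<in> A j" "i \<le> 1" "j \<le> 1" for i j
      using ad[of i j x y] that n by (auto simp: near_def)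
    then show ?thesis
      using that Dad[of x y] Dad[of y x] cadj_sym[of E x y] SV by (auto simp: S_def)
  qed
  \<comment> \<open>A path meets \<open>D\<close> and \<open>A 1\<close> through its first vertex,
    in \<open>A 2\<close>, and \<open>A 0\<close> through its last one, in
    \<open>A (n - 1)\<close>.\<close>
  have BS: "\<exists>i<L x. {P x i, y} \<in> E \<and> c (P x i) = c y" if x: "x \<in> B" and y: "y \<in> S" for x y
  proof -
    have edge: "{P x i, y} \<in> E" if "cadj E (P x i) y" "i + 2 < n" for i
      using that SA[OF y, of "i + 2"] PB[OF x that(2)] by (auto simp: cadj_def)
    have yV: "y \<in> V" using SV y by auto
    have PV: "P x i \<in> V" if "i + 2 < n" for i using PB[OF x that] that by (auto simp: V)
    consider "y \<in> D" | "y \<in> A 0" | "y \<in> A 1" using y by (auto simp: S_def)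
    then show ?thesis
    proof cases
      case 1
      then have "{P x 0, y} \<in> E" using Dad[OF 1 PV[of 0]] n edge[of 0] cadj_sym by fastforce
      then show ?thesis using cPB[OF x, of 0] cS[OF y] LB[OF x] n by (intro exI[of _ 0]) auto
    next
      case 2
      have "cadj E (P x (n - 3)) y"
        using ad[OF _ _ PB[OF x] 2, of "n - 3"] n by (auto simp: near_def)
      then have "{P x (n - 3), y} \<in> E" using edge[of "n - 3"] n by auto
      moreover have "even (n - 3)" using n by auto
      ultimately show ?thesis using cPB[OF x, of "n - 3"] cS[OF y] LB[OF x] n
        by (intro exI[of _ "n - 3"]) auto
    next
      case 3
      have "cadj E (P x 0) y"
        using ad[OF _ _ PB[OF x] 3, of 0] n by (auto simp: near_def)
      then have "{P x 0, y} \<in> E" using edge[of 0] n by auto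
      then show ?thesis using cPB[OF x, of 0] cS[OF y] LB[OF x] n by (intro exI[of _ 0]) auto
    qed
  qed
  have "has_odd_clique_minor V E (card (S \<union> B))"
  proof (rule odd_clique_minor_of_paths[where P = P and L = L and c = c])
    have fS: "finite S" using finite_subset[OF SV fV] .
    show "finite (S \<union> B)" using fS B(3) by simp
    show "0 < L x" if "x \<in> S \<union> B" for x using that LS LB n by auto
    show "P x i \<in> V" if "x \<in> S \<union> B" "i < L x" for x i
    proof (cases "x \<in> B")
      case True
      then have "i + 2 < n" using that LB by simp
      then show ?thesis using PB[OF True] by (auto simp: V)
    next
      case False
      then show ?thesis using that PS SV by auto
    qed
    show "x = y \<and> i = j" if xy: "x \<in> S \<union> B" "y \<in> S \<union> B" "i < L x" "j < L y" "P x i = P y j" for x y i j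
    proof -
      have s: False if "x \<in> B" "y \<in> S" "i < L x" "P x i = P y j" for x y i j
      proof -
        have l: "i + 2 < n" using that LB by simp
        then show False using PB[OF that(1) l] PS[OF that(2)] SA[OF that(2) _ _ l] that(4) by simp
      qed
      consider "x \<in> B" "y \<in> B" | "x \<in> S" "y \<in> S" | "x \<in> B" "y \<in> S" | "x \<in> S" "y \<in> B"
        using xy by auto
      then show ?thesis
      proof cases
        case 1
        then have l: "i + 2 < n" "j + 2 < n" using xy LB[of x] LB[of y] by auto
        have "i + 2 = j + 2"
          using disj[OF l, of "P x i"] PB[OF 1(1) l(1)] PB[OF 1(2) l(2)] xy(5) by simp
        then have ij: "i = j" by simp
        then have "h (i + 2) x = h (i + 2) y" using xy(5) 1 by (simp add: P_def)
        then show ?thesis using h[OF l(1)] 1 ij by (auto dest: inj_onD)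
      next
        case 2
        then show ?thesis using xy PS LS[of x] LS[of y] by auto
      next
        case 3
        then show ?thesis using s xy by blast
      next
        case 4
        then show ?thesis using s[of y x j i] xy by simp
      qed
    qed
    show "{P x i, P x (Suc i)} \<in> E \<and> c (P x i) \<noteq> c (P x (Suc i))"
      if xi: "x \<in> S \<union> B" "Suc i < L x" for x i
    proof -
      have x: "x \<in> B" using xi LS by force
      then have l: "i + 2 < n" "Suc i + 2 < n" using xi LB by auto
      have "cadj E (P x i) (P x (Suc i))"
        using ad[OF l PB[OF x l(1)] PB[OF x l(2)]] by (simp add: near_def)
      then show ?thesis
        using cPB[OF x l(1)] cPB[OF x l(2)] by (auto simp: cadj_def)
    qed
    show "\<exists>i<L x. \<exists>j<L y. {P x i, P y j} \<in> E \<and> c (P x i) = c (P y j)"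
      if xy: "x \<in> S \<union> B" "y \<in> S \<union> B" "x \<noteq> y" for x y
    proof -
      consider "x \<in> B" "y \<in> B" | "x \<in> S" "y \<in> S" | "x \<in> B" "y \<in> S" | "x \<in> S" "y \<in> B"
        using xy by auto
      then show ?thesis
      proof cases
        \<comment> \<open>Two paths are joined by their first vertices, since \<open>A 2\<close> is
          a clique.\<close>
        case 1
        have l: "0 + 2 < n" using n by simp
        have "cadj E (P x 0) (P y 0)"
          using ad[OF l l PB[OF 1(1) l] PB[OF 1(2) l]] by (simp add: near_def)
        moreover have "P x 0 \<noteq> P y 0"
          using h[OF l] 1 xy(3) inj_onD[of "h (0 + 2)" B x y] by (auto simp: P_def)
        ultimately show ?thesis
          using cPB[OF 1(1) l] cPB[OF 1(2) l] LB[OF 1(1)] LB[OF 1(2)] n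
          by (intro exI[of _ 0] conjI) (auto simp: cadj_def)
      next
        case 2
        have "{x, y} \<in> E" using SS[OF 2] xy(3) by (simp add: cadj_def)
        then show ?thesis
          using cS[OF 2(1)] cS[OF 2(2)] PS[OF 2(1)] PS[OF 2(2)] LS[OF 2(1)] LS[OF 2(2)] by auto
      next
        case 3
        then show ?thesis using BS[OF 3] PS[OF 3(2)] LS[OF 3(2)] by auto
      next
        case 4
        then show ?thesis using BS[OF 4(2,1)] PS[OF 4(1)] LS[OF 4(1)] by (auto simp: insert_commute)
      qed
    qed
  qed
  moreover have "card (S \<union> B) = card D + (card (A 0) + card (A 1)) + m"
  proof -
    have "card (A 0 \<union> A 1) = card (A 0) + card (A 1)"
      using fA[of 0] fA[of 1] disj[of 0 1] n by (intro card_Un_disjoint) auto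
    moreover have "card (D \<union> (A 0 \<union> A 1)) = card D + card (A 0 \<union> A 1)"
      using fA[of 0] fA[of 1] fD DA[of 0] DA[of 1] n by (intro card_Un_disjoint) auto
    moreover have "card (S \<union> B) = card S + card B"
      using finite_subset[OF SV fV] B(3) SB by (intro card_Un_disjoint) auto
    ultimately show ?thesis using B(2) by (simp add: S_def Un_assoc)
  qed
  ultimately show ?thesis by simp
qed

text \<open>For the colouring, rotation by \<open>s\<close> brings a smallest part to index 0; for
  the minor, rotation by \<open>r\<close> brings a heaviest cyclically consecutive pair to 0 and 1.
  Both counts equal \<open>card D + card (A s) + w r\<close>.\<close>

lemma cycle_blowup_bound:
  assumes g: "simple_graph V E" and b: "cycle_blowup V E n D A" and n: "5 \<le> n" "odd n"
  shows "\<exists>k c. proper_colouring V E k c \<and> has_odd_clique_minor V E k"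
proof -
  have fin: "finite {..<n}" "{..<n} \<noteq> {}" using n by (auto simp: lessThan_empty_iff)
  obtain s where s: "s < n" "\<And>i. i < n \<Longrightarrow> card (A s) \<le> card (A i)"
    using ex_is_arg_min_if_finite[OF fin, of "\<lambda>i. card (A i)"]
    by (auto simp: is_arg_min_linorder)
  define w where "w i = card (A i) + card (A (Suc i mod n))" for i
  obtain r where r: "r < n" "\<And>i. i < n \<Longrightarrow> w i \<le> w r"
    using obtains_MAX[OF fin, of w] by (metis Max_ge finite_imageI finite_lessThan imageI lessThan_iff)
  have n3: "3 \<le> n" using n by simp
  have m: "i mod n < n" for i using n by simp
  have "\<exists>c. proper_colouring V E (card D + card (A ((0 + s) mod n)) + w r) c"
  proof (rule cycle_blowup_colouring[OF g cycle_blowup_rotate[OF b n3] n3])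
    fix i assume "Suc i < n"
    have "w ((i + s) mod n) \<le> w r" using r(2) m by blast
    then show "card (A ((i + s) mod n)) + card (A ((Suc i + s) mod n)) \<le> w r"
      by (simp add: w_def mod_Suc_eq)
  qed
  moreover have "has_odd_clique_minor V E
      (card D + (card (A ((0 + r) mod n)) + card (A ((1 + r) mod n))) + card (A s))"
    by (rule cycle_blowup_odd_minor[OF g cycle_blowup_rotate[OF b n3] n]) (use s m in blast)
  ultimately show ?thesis
    using s(1) r(1) by (auto simp: w_def add_ac)
qed

section \<open>The comparison of the two numbers\<close>

theorem theorem2p2:
  fixes V :: "'a set" and E :: "'a set set"
  assumes "simple_graph V E"
    and "independence_number V E \<ge> 2"
    and "\<And>k. 4 \<le> k \<Longrightarrow> k \<le> 2 * independence_number V E \<Longrightarrow>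
           \<not> has_induced_subgraph V E {..<k} (cycle_edges k)"
  shows "odd_hadwiger_number V E \<ge> chromatic_number V E"
proof -
  note g = assms(1)
  let ?a = "independence_number V E"
  \<comment> \<open>One \<open>k\<close> that is both a number of colours and the size of an odd
    clique minor lies between the two invariants.\<close>
  have "\<exists>k c. proper_colouring V E k c \<and> has_odd_clique_minor V E k"
  proof (cases "chordal V E")
    case True
    have fV: "finite V" using g by (simp add: simple_graph_def)
    obtain K c where K: "K \<subseteq> V" "clique K E" "proper_colouring V E (card K) c"
      using chordal_colouring[OF no_loop[OF g] fV True] by blast
    then show ?thesis using clique_odd_minor[of K V E] finite_subset[OF K(1) fV] by blast
  next
    case False
    then obtain n f where h: "hole V E n f" "4 \<le> n" by (auto simp: chordal_def)
    interpret long_hole_graph V E ?a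
    proof
      show "n = 2 * ?a + 1" if h: "hole V E n f" and n4: "4 \<le> n" for n f
      proof (rule ccontr)
        assume ne: "n \<noteq> 2 * ?a + 1"
        have "has_induced_subgraph V E {..<n} (cycle_edges n)"
          using hole_imp_induced_cycle[OF g h] n4 by simp
        then have n: "2 * ?a + 2 \<le> n" using assms(3)[OF n4] ne by fastforce
        \<comment> \<open>As \<open>2 * ?a\<close> is at most \<open>n - 2\<close>, the last even
          position is not adjacent to position 0, and these \<open>?a + 1\<close> vertices are
          independent.\<close>
        define T where "T = (\<lambda>k. f (2 * k)) ` {..?a}"
        have "inj_on (\<lambda>k. f (2 * k)) {..?a}"
        proof (rule inj_onI)
          fix k l assume "k \<in> {..?a}" "l \<in> {..?a}" "f (2 * k) = f (2 * l)"
          then have "2 * k = 2 * l"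
            using h n unfolding hole_def by (intro inj_onD[of f "{..<n}"]) auto
          then show "k = l" by simp
        qed
        then have "card T = Suc ?a" by (simp add: T_def card_image)
        moreover have "T \<subseteq> V" using h n by (auto simp: T_def hole_def)
        moreover have "{f (2 * k), f (2 * l)} \<notin> E" if "k \<le> ?a" "l \<le> ?a" for k l
          using hole_edge[OF no_loop[OF g] h, of "2 * k" "2 * l"] that n
          by (auto simp: near_def)
        then have "indep T E" by (auto simp: T_def indep_def)
        ultimately show False
          using independence_number_attained(2)[OF g, of T] by simp
      qed
    qed (use assms independence_number_attained(2)[OF g] in auto)
    obtain D A where "cycle_blowup V E n D A" using hole_cycle_blowup[OF h] by blast
    then show ?thesis
      using cycle_blowup_bound[OF g] hole_length[OF h] a2 by simp
  qed
  then obtain k c where kc: "proper_colouring V E k c" "has_odd_clique_minor V E k" by blast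
  have "chromatic_number V E \<le> k"
    unfolding chromatic_number_def by (rule Least_le) (use kc in blast)
  also have "k \<le> odd_hadwiger_number V E"
    using odd_hadwiger_number_attained(2)[OF g kc(2)] .
  finally show ?thesis .
qed

end
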